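(* Let $X,Y$ be normed spaces and let $\omega:(0,\infty)\to(0,\infty)$ be a non-decreasing function such that $\lim_{t\to 0}\omega(t)=0$, $\lim_{t\to\infty}\omega(t)=\infty$, $\lim_{t\to 0}t/\omega(t)=0$, and, for some constant $C_{\mathrm{db}}>1$, $\omega(2t)\le C_{\mathrm{db}}\,\omega(t)$ for all $t\in(0,\infty)$. Then $$\dot{\mathrm{VC}}^{0,\omega}(X,Y)=\overline{\dot{\mathrm{VC}}^{0,\omega}_{\mathrm{small}}(X,Y)\cap C_{\mathrm{bs}}(X,Y)}^{\,\dot C^{0,\omega}(X,Y)}.$$
   Context: For normed spaces $X,Y$, $\dot C^{0,\omega}(X,Y)$ is the set of $f:X\to Y$ with $\|f\|_{\dot C^{0,\omega}(X,Y)}:=\sup_{x\ne y}\frac{\|f(x)-f(y)\|_Y}{\omega(\|x-y\|_X)}<\infty$. For $x\neq y$ put $\mathrm{osc}^\omega_{(x,y)}(f)=\frac{\|f(x)-f(y)\|_Y}{\omega(\|x-y\|_X)}$, and for $\delta>0$ put $\mathrm{osc}^\omega_\delta(f)=\sup\{\mathrm{osc}^\omega_{(x,y)}(f): x,y\in X,\ \|x-y\|_X=\delta\}$. Define $\dot{\mathrm{VC}}^{0,\omega}_{\mathrm{small}}(X,Y)=\{f\in\dot C^{0,\omega}(X,Y):\lim_{\delta\to0}\mathrm{osc}^\omega_\delta(f)=0\}$, $\dot{\mathrm{VC}}^{0,\omega}_{\mathrm{large}}(X,Y)=\{f\in\dot C^{0,\omega}(X,Y):\lim_{\delta\to\infty}\mathrm{osc}^\omega_\delta(f)=0\}$,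 $\dot{\mathrm{VC}}^{0,\omega}_{\mathrm{far}}(X,Y)=\{f\in\dot C^{0,\omega}(X,Y):\lim_{\delta\to\infty}\sup_{x\ne y,\ \min(\|x\|,\|y\|)>\delta}\mathrm{osc}^\omega_{(x,y)}(f)=0\}$, and $\dot{\mathrm{VC}}^{0,\omega}(X,Y)$ as the intersection of these three sets. $C_{\mathrm{bs}}(X,Y)$ is the set of continuous functions $X\to Y$ with bounded support (vanishing outside some ball $B(0,R)$). For $\mathcal C\subset\dot C^{0,\omega}(X,Y)$, $\overline{\mathcal C}^{\,\dot C^{0,\omega}(X,Y)}$ is the set of $f\in\dot C^{0,\omega}(X,Y)$ for which there is a sequence $(f_n)\subset\mathcal C$ with $\|f_n-f\|_{\dot C^{0,\omega}(X,Y)}\to0$ (closure with respect to the seminorm). *)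

theory Defs
  imports "HOL-Analysis.Analysis"
begin

text \<open>
  The modulus is a total function on the reals, but it is only ever evaluated at positive
  arguments. Suprema are taken in \<^typ>\<open>ennreal\<close>: unbounded ones are \<open>\<infinity>\<close>, and a supremum over
  the empty set (which occurs when \<open>X\<close> is trivial) is 0.
\<close>

definition osc_pair ::
    "(real \<Rightarrow> real) \<Rightarrow> ('a::real_normed_vector \<Rightarrow> 'b::real_normed_vector) \<Rightarrow> 'a \<Rightarrow> 'a \<Rightarrow> ennreal"
  where "osc_pair \<omega> f x y = ennreal (norm (f x - f y) / \<omega> (norm (x - y)))"

definition holder_seminorm ::
    "(real \<Rightarrow> real) \<Rightarrow> ('a::real_normed_vector \<Rightarrow> 'b::real_normed_vector) \<Rightarrow> ennreal"
  where "holder_seminorm \<omega> f = (SUP (x, y)\<in>{(x, y). x \<noteq> y}. osc_pair \<omega> f x y)"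

definition holder_space ::
    "(real \<Rightarrow> real) \<Rightarrow> ('a::real_normed_vector \<Rightarrow> 'b::real_normed_vector) set"
  where "holder_space \<omega> = {f. holder_seminorm \<omega> f < \<infinity>}"

definition osc_at ::
    "(real \<Rightarrow> real) \<Rightarrow> real \<Rightarrow> ('a::real_normed_vector \<Rightarrow> 'b::real_normed_vector) \<Rightarrow> ennreal"
  where "osc_at \<omega> \<delta> f = (SUP (x, y)\<in>{(x, y). norm (x - y) = \<delta>}. osc_pair \<omega> f x y)"

definition osc_far ::
    "(real \<Rightarrow> real) \<Rightarrow> real \<Rightarrow> ('a::real_normed_vector \<Rightarrow> 'b::real_normed_vector) \<Rightarrow> ennreal"
  where "osc_far \<omega> \<delta> f =
    (SUP (x, y)\<in>{(x, y). x \<noteq> y \<and> min (norm x) (norm y) > \<delta>}. osc_pair \<omega> f x y)"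

definition VC_small ::
    "(real \<Rightarrow> real) \<Rightarrow> ('a::real_normed_vector \<Rightarrow> 'b::real_normed_vector) set"
  where "VC_small \<omega> = {f \<in> holder_space \<omega>. ((\<lambda>\<delta>. osc_at \<omega> \<delta> f) \<longlongrightarrow> 0) (at_right 0)}"

definition VC_large ::
    "(real \<Rightarrow> real) \<Rightarrow> ('a::real_normed_vector \<Rightarrow> 'b::real_normed_vector) set"
  where "VC_large \<omega> = {f \<in> holder_space \<omega>. ((\<lambda>\<delta>. osc_at \<omega> \<delta> f) \<longlongrightarrow> 0) at_top}"

definition VC_far ::
    "(real \<Rightarrow> real) \<Rightarrow> ('a::real_normed_vector \<Rightarrow> 'b::real_normed_vector) set"
  where "VC_far \<omega> = {f \<in> holder_space \<omega>. ((\<lambda>\<delta>. osc_far \<omega> \<delta> f) \<longlongrightarrow> 0) at_top}"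

definition VC ::
    "(real \<Rightarrow> real) \<Rightarrow> ('a::real_normed_vector \<Rightarrow> 'b::real_normed_vector) set"
  where "VC \<omega> = VC_small \<omega> \<inter> VC_large \<omega> \<inter> VC_far \<omega>"

definition C_bs :: "('a::real_normed_vector \<Rightarrow> 'b::real_normed_vector) set"
  where "C_bs = {f. continuous_on UNIV f \<and> (\<exists>R>0. \<forall>x. x \<notin> ball 0 R \<longrightarrow> f x = 0)}"

definition holder_closure ::
    "(real \<Rightarrow> real) \<Rightarrow> ('a::real_normed_vector \<Rightarrow> 'b::real_normed_vector) set \<Rightarrow> ('a \<Rightarrow> 'b) set"
  where "holder_closure \<omega> C = {f \<in> holder_space \<omega>. \<exists>F :: nat \<Rightarrow> 'a \<Rightarrow> 'b.
    (\<forall>n. F n \<in> C) \<and> (\<lambda>n. holder_seminorm \<omega> (\<lambda>x. F n x - f x)) \<longlonglongrightarrow> 0}"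

end

theory Submission imports Defs begin

text \<open>
  For the inclusion from left to right, \<open>f\<close> is approximated by the cutoffs \<open>\<phi>\<^sub>R (f - f 0)\<close>, where
  \<open>\<phi>\<^sub>R\<close> is 1 on the ball of radius \<open>2R\<close>, 0 outside that of radius \<open>4R\<close> and linear in the norm in
  between. The error is the seminorm of \<open>(1 - \<phi>\<^sub>R)(f - f 0)\<close>, whose critical part is
  \<open>(t / R) |f y - f 0|\<close> for \<open>R \<le> |y| \<le> 4R\<close> and \<open>t = |x - y| \<le> R\<close>. Since \<open>\<omega> t / t\<close> need not be
  almost decreasing, this cannot be estimated by \<open>\<omega> R\<close>; instead the segment from 0 to \<open>y\<close>
  is divided into about \<open>|y| / t\<close> pieces of length comparable to \<open>t\<close>. If \<open>t\<close> is large, each piece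
  contributes at most \<open>\<epsilon> \<omega> t\<close> by the vanishing at large scales; if \<open>t\<close> is bounded, all pieces
  outside a fixed ball do so by the vanishing far away, and the contribution of the
  fixed ball disappears as \<open>R\<close> tends to infinity.
\<close>

section \<open>Convergence to zero of extended nonnegative quantities\<close>

text \<open>The non-strict bound by a real e is the form that \<open>SUP_le_iff\<close> turns into
  pointwise inequalities. Conversely, a strict extended bound a follows from a finite positive b
  below a.\<close>

lemma ennreal_tendsto_0_iff:
  fixes u :: "'c \<Rightarrow> ennreal"
  shows "(u \<longlongrightarrow> 0) F \<longleftrightarrow> (\<forall>e>0. eventually (\<lambda>x. u x \<le> ennreal e) F)"
proof
  assume u: "(u \<longlongrightarrow> 0) F"
  show "\<forall>e>0. eventually (\<lambda>x. u x \<le> ennreal e) F"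
  proof (intro allI impI)
    fix e :: real assume "e > 0"
    then have "eventually (\<lambda>x. u x < ennreal e) F"
      using order_tendstoD(2)[OF u, of "ennreal e"] by simp
    then show "eventually (\<lambda>x. u x \<le> ennreal e) F"
      by eventually_elim simp
  qed
next
  assume *: "\<forall>e>0. eventually (\<lambda>x. u x \<le> ennreal e) F"
  show "(u \<longlongrightarrow> 0) F"
  proof (rule order_tendstoI)
    fix a :: ennreal assume "a < 0" then show "eventually (\<lambda>x. a < u x) F" by simp
  next
    fix a :: ennreal assume "0 < a"
    then obtain b where b: "0 < b" "b < a" using dense by blast
    have "b < top" using b(2) by (rule less_le_trans) simp
    then have "b = ennreal (enn2real b)" "enn2real b > 0"
      using b by (simp_all add: enn2real_positive_iff)
    then have "eventually (\<lambda>x. u x \<le> b) F" using * by metis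
    then show "eventually (\<lambda>x. u x < a) F" by eventually_elim (use b in auto)
  qed
qed

section \<open>Chaining along a segment\<close>

text \<open>Cut the segment into N equal pieces, N being \<open>norm (x - y) / t\<close> rounded up,
  and telescope. The lower bound t/2 on the length of a piece is what makes vanishing at large
  scales applicable to it.\<close>

lemma norm_diff_le_chain:
  fixes f :: "'a::real_normed_vector \<Rightarrow> 'b::real_normed_vector"
  assumes t: "0 < t" "t \<le> norm (x - y)"
    and B: "\<And>u v. u \<in> closed_segment x y \<Longrightarrow> v \<in> closed_segment x y \<Longrightarrow>
      t / 2 \<le> norm (u - v) \<Longrightarrow> norm (u - v) \<le> t \<Longrightarrow> norm (f u - f v) \<le> B"
  shows "norm (f x - f y) \<le> 2 * norm (x - y) / t * B"
proof -
  define L where "L = norm (x - y)"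
  define N where "N = nat \<lceil>L / t\<rceil>"
  define p where "p i = x + (real i / real N) *\<^sub>R (y - x)" for i
  have Lt: "L / t \<ge> 1" using t by (simp add: L_def)
  have N_lower: "L / t \<le> real N" unfolding N_def by linarith
  \<comment> \<open>Rounding up adds less than 1, and 1 is at most L/t.\<close>
  have N_upper: "real N \<le> 2 * (L / t)" using Lt unfolding N_def by linarith
  have N: "real N > 0" using N_lower Lt by linarith
  have seg: "p i \<in> closed_segment x y" if "i \<le> N" for i
    unfolding in_segment p_def using that N
    by (intro exI[of _ "real i / real N"]) (auto simp: algebra_simps)
  have step: "norm (p i - p (Suc i)) = L / real N" for i
  proof -
    have "p i - p (Suc i) = (real i / real N - real (Suc i) / real N) *\<^sub>R (y - x)"
      by (simp add: p_def scaleR_diff_left)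
    also have "real i / real N - real (Suc i) / real N = - (1 / real N)"
      using N by (simp add: field_simps)
    finally show ?thesis by (simp add: L_def norm_minus_commute)
  qed
  have piece: "norm (f (p i) - f (p (Suc i))) \<le> B" if "i < N" for i
  proof (rule B)
    show "p i \<in> closed_segment x y" "p (Suc i) \<in> closed_segment x y"
      using that by (auto intro: seg)
    show "norm (p i - p (Suc i)) \<le> t" "t / 2 \<le> norm (p i - p (Suc i))"
      using N N_lower N_upper t unfolding step by (simp_all add: field_simps)
  qed
  have "f x - f y = f (p 0) - f (p N)" using N by (simp add: p_def)
  also have "\<dots> = (\<Sum>i<N. f (p i) - f (p (Suc i)))" by (simp add: sum_lessThan_telescope'[of "\<lambda>i. f (p i)"])
  finally have "norm (f x - f y) \<le> (\<Sum>i<N. B)"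
    using piece by (metis (no_types, lifting) sum_norm_le lessThan_iff)
  also have "\<dots> = real N * B" by simp
  also have "\<dots> \<le> 2 * (L / t) * B"
  proof (rule mult_right_mono[OF N_upper])
    \<comment> \<open>Nonnegativity of B is no assumption; it comes from the first piece, which
      exists because N is positive.\<close>
    show "0 \<le> B" using piece[of 0] N norm_ge_zero order_trans by (metis of_nat_0_less_iff)
  qed
  finally show ?thesis by (simp add: L_def)
qed

lemma scaled_norm_diff_le_chain:
  fixes f :: "'a::real_normed_vector \<Rightarrow> 'b::real_normed_vector"
  assumes t: "0 < t" "t \<le> norm (x - y)"
    and B: "\<And>u v. u \<in> closed_segment x y \<Longrightarrow> v \<in> closed_segment x y \<Longrightarrow>
      t / 2 \<le> norm (u - v) \<Longrightarrow> norm (u - v) \<le> t \<Longrightarrow> norm (f u - f v) \<le> B"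
  shows "t * norm (f x - f y) \<le> 2 * norm (x - y) * B"
  using norm_diff_le_chain[OF t B] t by (simp add: field_simps)

section \<open>The seminorm and the three vanishing conditions as real inequalities\<close>

text \<open>Only the standing assumptions are bundled; limit conditions on \<omega> appear as
  explicit hypotheses of the lemmas where they enter.\<close>

locale modulus =
  fixes \<omega> :: "real \<Rightarrow> real"
  assumes pos: "t > 0 \<Longrightarrow> \<omega> t > 0"
    and mono: "mono_on {0<..} \<omega>"
begin

lemma le: "0 < s \<Longrightarrow> s \<le> t \<Longrightarrow> \<omega> s \<le> \<omega> t"
  using mono by (auto simp: mono_on_def)

lemma osc_pair_le_iff:
  assumes "x \<noteq> y" "0 \<le> e"
  shows "osc_pair \<omega> f x y \<le> ennreal e \<longleftrightarrow> norm (f x - f y) \<le> e * \<omega> (norm (x - y))"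
  unfolding osc_pair_def using assms pos[of "norm (x - y)"]
  by (simp add: divide_simps)

lemma holder_seminorm_le_iff:
  assumes "0 \<le> e"
  shows "holder_seminorm \<omega> f \<le> ennreal e \<longleftrightarrow>
    (\<forall>x y. x \<noteq> y \<longrightarrow> norm (f x - f y) \<le> e * \<omega> (norm (x - y)))"
  using assms by (auto simp: holder_seminorm_def SUP_le_iff osc_pair_le_iff)

lemma holder_space_iff:
  "f \<in> holder_space \<omega> \<longleftrightarrow>
    (\<exists>K\<ge>0. \<forall>x y. x \<noteq> y \<longrightarrow> norm (f x - f y) \<le> K * \<omega> (norm (x - y)))"
proof
  assume "f \<in> holder_space \<omega>"
  then have "holder_seminorm \<omega> f \<le> ennreal (enn2real (holder_seminorm \<omega> f))"
    by (simp add: holder_space_def)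
  then show "\<exists>K\<ge>0. \<forall>x y. x \<noteq> y \<longrightarrow> norm (f x - f y) \<le> K * \<omega> (norm (x - y))"
    by (metis enn2real_nonneg holder_seminorm_le_iff)
next
  assume "\<exists>K\<ge>0. \<forall>x y. x \<noteq> y \<longrightarrow> norm (f x - f y) \<le> K * \<omega> (norm (x - y))"
  then obtain K where "holder_seminorm \<omega> f \<le> ennreal K"
    by (auto simp flip: holder_seminorm_le_iff)
  then show "f \<in> holder_space \<omega>"
    by (simp add: holder_space_def le_less_trans)
qed

lemma osc_at_le_iff:
  assumes "0 \<le> e" "0 < \<delta>"
  shows "osc_at \<omega> \<delta> f \<le> ennreal e \<longleftrightarrow>
    (\<forall>x y. norm (x - y) = \<delta> \<longrightarrow> norm (f x - f y) \<le> e * \<omega> \<delta>)"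
proof -
  have "osc_pair \<omega> f x y \<le> ennreal e \<longleftrightarrow> norm (f x - f y) \<le> e * \<omega> \<delta>" if "norm (x - y) = \<delta>" for x y
    using osc_pair_le_iff[of x y e f] that assms by auto
  then show ?thesis by (auto simp: osc_at_def SUP_le_iff)
qed

lemma osc_far_le_iff:
  assumes "0 \<le> e"
  shows "osc_far \<omega> \<delta> f \<le> ennreal e \<longleftrightarrow>
    (\<forall>x y. x \<noteq> y \<longrightarrow> \<delta> < norm x \<longrightarrow> \<delta> < norm y \<longrightarrow> norm (f x - f y) \<le> e * \<omega> (norm (x - y)))"
  using assms by (auto simp: osc_far_def SUP_le_iff osc_pair_le_iff)

text \<open>For fixed e, the bounds on the suprema at all distances below d merge into a single
  estimate for distinct points closer than d.\<close>

lemma VC_small_iff: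
  "f \<in> VC_small \<omega> \<longleftrightarrow> f \<in> holder_space \<omega> \<and> (\<forall>e>0. \<exists>d>0. \<forall>x y. x \<noteq> y \<longrightarrow> norm (x - y) < d \<longrightarrow>
    norm (f x - f y) \<le> e * \<omega> (norm (x - y)))"
proof -
  have "eventually (\<lambda>\<delta>. osc_at \<omega> \<delta> f \<le> ennreal e) (at_right 0) \<longleftrightarrow>
      (\<exists>d>0. \<forall>x y. x \<noteq> y \<longrightarrow> norm (x - y) < d \<longrightarrow> norm (f x - f y) \<le> e * \<omega> (norm (x - y)))"
    if "e > 0" for e
    using that by (force simp: eventually_at_right_field osc_at_le_iff)
  then show ?thesis
    by (simp add: VC_small_def ennreal_tendsto_0_iff)
qed

lemma VC_large_iff:
  "f \<in> VC_large \<omega> \<longleftrightarrow> f \<in> holder_space \<omega> \<and> (\<forall>e>0. \<exists>S>0. \<forall>x y. S \<le> norm (x - y) \<longrightarrow>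
    norm (f x - f y) \<le> e * \<omega> (norm (x - y)))"
proof -
  have "eventually (\<lambda>\<delta>. osc_at \<omega> \<delta> f \<le> ennreal e) at_top \<longleftrightarrow>
      (\<exists>S>0. \<forall>x y. S \<le> norm (x - y) \<longrightarrow> norm (f x - f y) \<le> e * \<omega> (norm (x - y)))"
    (is "?L \<longleftrightarrow> ?R") if e: "e > 0" for e
  proof
    assume ?L
    then obtain S where S: "\<And>\<delta>. \<delta> \<ge> S \<Longrightarrow> osc_at \<omega> \<delta> f \<le> ennreal e"
      by (auto simp: eventually_at_top_linorder)
    \<comment> \<open>The limit at infinity gives a threshold of unknown sign; the maximum with 1
      makes it positive, so that only distinct points are compared.\<close>
    show ?R
    proof (intro exI[of _ "max S 1"] conjI allI impI)
      fix x y :: 'a assume "max S 1 \<le> norm (x - y)"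
      then show "norm (f x - f y) \<le> e * \<omega> (norm (x - y))"
        using S[of "norm (x - y)"] e osc_at_le_iff[of e "norm (x - y)" f] by force
    qed auto
  next
    assume ?R
    then obtain S where S: "S > 0" "\<And>x y. S \<le> norm (x - y) \<Longrightarrow> norm (f x - f y) \<le> e * \<omega> (norm (x - y))"
      by auto
    have "osc_at \<omega> \<delta> f \<le> ennreal e" if "\<delta> \<ge> S" for \<delta>
      using S e that by (subst osc_at_le_iff) auto
    then show ?L by (auto simp: eventually_at_top_linorder)
  qed
  then show ?thesis
    by (simp add: VC_large_def ennreal_tendsto_0_iff)
qed

lemma VC_far_iff:
  "f \<in> VC_far \<omega> \<longleftrightarrow> f \<in> holder_space \<omega> \<and> (\<forall>e>0. \<exists>S>0. \<forall>x y. x \<noteq> y \<longrightarrow> S < norm x \<longrightarrow> S < norm y \<longrightarrow>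
    norm (f x - f y) \<le> e * \<omega> (norm (x - y)))"
proof -
  have "eventually (\<lambda>\<delta>. osc_far \<omega> \<delta> f \<le> ennreal e) at_top \<longleftrightarrow>
      (\<exists>S>0. \<forall>x y. x \<noteq> y \<longrightarrow> S < norm x \<longrightarrow> S < norm y \<longrightarrow> norm (f x - f y) \<le> e * \<omega> (norm (x - y)))"
    (is "?L \<longleftrightarrow> ?R") if e: "e > 0" for e
  proof
    assume ?L
    then obtain S where S: "\<And>\<delta>. \<delta> \<ge> S \<Longrightarrow> osc_far \<omega> \<delta> f \<le> ennreal e"
      by (auto simp: eventually_at_top_linorder)
    show ?R
      using S[of "max S 1"] e by (intro exI[of _ "max S 1"]) (auto simp: osc_far_le_iff)
  next
    assume ?R
    then obtain S where S: "\<And>x y. x \<noteq> y \<Longrightarrow> S < norm x \<Longrightarrow> S < norm y \<Longrightarrow>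
        norm (f x - f y) \<le> e * \<omega> (norm (x - y))"
      by auto
    have "osc_far \<omega> \<delta> f \<le> ennreal e" if "\<delta> \<ge> S" for \<delta>
      using S e that by (subst osc_far_le_iff) auto
    then show ?L by (auto simp: eventually_at_top_linorder)
  qed
  then show ?thesis
    by (simp add: VC_far_def ennreal_tendsto_0_iff)
qed

section \<open>Holder functions: continuity, and bounded support\<close>

lemma continuous_on_holder_space:
  assumes zero: "(\<omega> \<longlongrightarrow> 0) (at_right 0)" and f: "f \<in> holder_space \<omega>"
  shows "continuous_on UNIV f"
proof -
  obtain K where K: "K \<ge> 0" "\<And>x y. x \<noteq> y \<Longrightarrow> norm (f x - f y) \<le> K * \<omega> (norm (x - y))"
    using f by (auto simp: holder_space_iff)
  show ?thesis
    unfolding continuous_on_iff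
  proof (intro ballI allI impI)
    fix x and e :: real assume e: "e > 0"
    have "((\<lambda>t. K * \<omega> t) \<longlongrightarrow> K * 0) (at_right 0)" by (intro tendsto_intros zero)
    then have "eventually (\<lambda>t. K * \<omega> t < e) (at_right 0)" using e by (auto dest: order_tendstoD(2))
    then obtain d where d: "d > 0" "\<And>t. 0 < t \<Longrightarrow> t < d \<Longrightarrow> K * \<omega> t < e"
      by (auto simp: eventually_at_right_field)
    have "dist (f x') (f x) < e" if "dist x' x < d" for x'
    proof (cases "x' = x")
      case False
      then show ?thesis
        using K(2)[OF False] d(2)[of "norm (x' - x)"] that unfolding dist_norm by force
    qed (use e in simp)
    then show "\<exists>d>0. \<forall>x'\<in>UNIV. dist x' x < d \<longrightarrow> dist (f x') (f x) < e" using d(1) by auto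
  qed
qed

text \<open>If two points at distance at least 2R exist, the values of f at them are bounded by
  \<open>K * \<omega> (2 * R)\<close>, where R is a radius of the support. Since \<omega> tends to
  infinity, the quotient tends to 0.\<close>

lemma holder_C_bs_in_VC_large:
  assumes infinity: "filterlim \<omega> at_top at_top"
    and f: "f \<in> holder_space \<omega>" "f \<in> C_bs"
  shows "f \<in> VC_large \<omega>"
  unfolding VC_large_iff
proof (intro conjI allI impI f(1))
  fix e :: real assume e: "e > 0"
  obtain K where K: "K \<ge> 0" "\<And>x y. x \<noteq> y \<Longrightarrow> norm (f x - f y) \<le> K * \<omega> (norm (x - y))"
    using f by (auto simp: holder_space_iff)
  obtain R where R: "R > 0" "\<And>x. norm x \<ge> R \<Longrightarrow> f x = 0"
    using f by (auto simp: C_bs_def)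
  obtain T where T: "\<And>t. t \<ge> T \<Longrightarrow> K * \<omega> (2 * R) / e \<le> \<omega> t"
    using infinity by (auto simp: filterlim_at_top eventually_at_top_linorder)
  have bound: "norm (f x) \<le> K * \<omega> (2 * R)" if "norm x < R" "2 * R \<le> norm (x - y)" for x y
  proof -
    \<comment> \<open>Walk the distance 2R from x towards y. This leaves the ball of radius R around
      0, so f vanishes at z and the Holder bound for x and z bounds f at x.\<close>
    define z where "z = x + (2 * R / norm (x - y)) *\<^sub>R (y - x)"
    have "norm (x - z) = 2 * R" "x \<noteq> z"
      using that R by (auto simp: z_def norm_minus_commute)
    moreover have "norm z \<ge> R" using \<open>norm (x - z) = 2 * R\<close> that norm_triangle_ineq4[of x z] by linarith
    ultimately show ?thesis using K(2)[of x z] R(2)[of z] by simp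
  qed
  have "norm (f x - f y) \<le> e * \<omega> (norm (x - y))" if far: "max T (2 * R) \<le> norm (x - y)" for x y
  proof -
    have "norm (f x - f y) \<le> K * \<omega> (2 * R)"
    proof -
      \<comment> \<open>Points at distance at least 2R cannot both have norm below R, so at most one
        of the two values is nonzero.\<close>
      consider "norm x < R" "norm y \<ge> R" | "norm y < R" "norm x \<ge> R" | "norm x \<ge> R" "norm y \<ge> R"
        using far norm_triangle_ineq4[of x y] by fastforce
      then show ?thesis
        using bound[of x y] bound[of y x] R far K(1) pos[of "2 * R"]
        by cases (auto simp: norm_minus_commute)
    qed
    also have "\<dots> \<le> e * \<omega> (norm (x - y))"
      using T[of "norm (x - y)"] far e by (simp add: field_simps)
    finally show ?thesis .
  qed
  then show "\<exists>S>0. \<forall>x y. S \<le> norm (x - y) \<longrightarrow> norm (f x - f y) \<le> e * \<omega> (norm (x - y))"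
    using R by (intro exI[of _ "max T (2 * R)"]) auto
qed

lemma holder_C_bs_in_VC_far:
  assumes f: "f \<in> holder_space \<omega>" "f \<in> C_bs"
  shows "f \<in> VC_far \<omega>"
proof -
  obtain R where R: "R > 0" "\<And>x. norm x \<ge> R \<Longrightarrow> f x = 0"
    using f by (auto simp: C_bs_def)
  show ?thesis
    unfolding VC_far_iff
  proof (intro conjI allI impI f(1), intro exI[of _ R] conjI allI impI R(1))
    fix e :: real and x y :: 'a
    assume "e > 0" "x \<noteq> y" "R < norm x" "R < norm y"
    then show "norm (f x - f y) \<le> e * \<omega> (norm (x - y))"
      using R(2)[of x] R(2)[of y] pos[of "norm (x - y)"] by simp
  qed
qed

section \<open>Closedness under the seminorm\<close>

text \<open>An e/2 argument: the oscillation of f on a pair exceeds that of an approximant g by at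
  most the seminorm of g - f.\<close>

lemma holder_closure_VC_subset:
  "holder_closure \<omega> (VC \<omega>) \<subseteq> (VC \<omega> :: ('a::real_normed_vector \<Rightarrow> 'b::real_normed_vector) set)"
proof
  fix f :: "'a \<Rightarrow> 'b" assume f: "f \<in> holder_closure \<omega> (VC \<omega>)"
  then have hf: "f \<in> holder_space \<omega>" by (simp add: holder_closure_def)
  \<comment> \<open>Stated pair by pair, so that it transfers any of the three conditions, whichever
    set of pairs that condition ranges over.\<close>
  have approx: "\<exists>g\<in>(VC \<omega> :: ('a \<Rightarrow> 'b) set). \<forall>x y. x \<noteq> y \<longrightarrow>
    norm (g x - g y) \<le> (e/2) * \<omega> (norm (x - y)) \<longrightarrow> norm (f x - f y) \<le> e * \<omega> (norm (x - y))"
    if e: "e > 0" for e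
  proof -
    obtain F where F: "\<And>n. F n \<in> VC \<omega>" "(\<lambda>n. holder_seminorm \<omega> (\<lambda>x. F n x - f x)) \<longlonglongrightarrow> 0"
      using f by (auto simp: holder_closure_def)
    have "\<forall>\<^sub>F n in sequentially. holder_seminorm \<omega> (\<lambda>x. F n x - f x) \<le> ennreal (e/2)"
      using F(2) e by (simp add: ennreal_tendsto_0_iff)
    then obtain n where "holder_seminorm \<omega> (\<lambda>x. F n x - f x) \<le> ennreal (e/2)"
      by (auto simp: eventually_sequentially)
    then have n: "norm ((F n x - f x) - (F n y - f y)) \<le> (e/2) * \<omega> (norm (x - y))" if "x \<noteq> y" for x y
      using e that by (simp add: holder_seminorm_le_iff)
    have close: "norm (f x - f y) \<le> e * \<omega> (norm (x - y))"
      if "x \<noteq> y" "norm (F n x - F n y) \<le> (e/2) * \<omega> (norm (x - y))" for x y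
    proof -
      have "f x - f y = (F n x - F n y) - ((F n x - f x) - (F n y - f y))" by simp
      then have "norm (f x - f y) \<le> norm (F n x - F n y) + norm ((F n x - f x) - (F n y - f y))"
        by (metis norm_triangle_ineq4)
      then show ?thesis using n[OF that(1)] that(2) by simp
    qed
    show ?thesis by (intro bexI[OF _ F(1)[of n]] allI impI close)
  qed
  have "f \<in> VC_small \<omega>"
    unfolding VC_small_iff
  proof (intro conjI hf allI impI)
    fix e :: real assume e: "e > 0"
    obtain g :: "'a \<Rightarrow> 'b" where g: "g \<in> VC \<omega>" "\<forall>x y. x \<noteq> y \<longrightarrow>
        norm (g x - g y) \<le> (e/2) * \<omega> (norm (x - y)) \<longrightarrow> norm (f x - f y) \<le> e * \<omega> (norm (x - y))"
      using approx[OF e] by (rule bexE)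
    obtain d where "d > 0" "\<forall>x y. x \<noteq> y \<longrightarrow> norm (x - y) < d \<longrightarrow> norm (g x - g y) \<le> (e/2) * \<omega> (norm (x - y))"
      using g(1) half_gt_zero[OF e] unfolding VC_def Int_iff VC_small_iff by blast
    then show "\<exists>d>0. \<forall>x y. x \<noteq> y \<longrightarrow> norm (x - y) < d \<longrightarrow> norm (f x - f y) \<le> e * \<omega> (norm (x - y))"
      using g(2) by (intro exI[of _ d]) simp
  qed
  moreover have "f \<in> VC_large \<omega>"
    unfolding VC_large_iff
  proof (intro conjI hf allI impI)
    fix e :: real assume e: "e > 0"
    obtain g :: "'a \<Rightarrow> 'b" where g: "g \<in> VC \<omega>" "\<forall>x y. x \<noteq> y \<longrightarrow>
        norm (g x - g y) \<le> (e/2) * \<omega> (norm (x - y)) \<longrightarrow> norm (f x - f y) \<le> e * \<omega> (norm (x - y))"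
      using approx[OF e] by (rule bexE)
    obtain S where S: "S > 0" "\<And>x y. S \<le> norm (x - y) \<Longrightarrow> norm (g x - g y) \<le> (e/2) * \<omega> (norm (x - y))"
      using g(1) half_gt_zero[OF e] unfolding VC_def Int_iff VC_large_iff by blast
    have "norm (f x - f y) \<le> e * \<omega> (norm (x - y))" if "S \<le> norm (x - y)" for x y
    proof -
      have "x \<noteq> y" using that S(1) by auto
      then show ?thesis using g(2) S(2)[OF that] by blast
    qed
    then show "\<exists>S>0. \<forall>x y. S \<le> norm (x - y) \<longrightarrow> norm (f x - f y) \<le> e * \<omega> (norm (x - y))"
      using S(1) by blast
  qed
  moreover have "f \<in> VC_far \<omega>"
    unfolding VC_far_iff
  proof (intro conjI hf allI impI)
    fix e :: real assume e: "e > 0"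
    obtain g :: "'a \<Rightarrow> 'b" where g: "g \<in> VC \<omega>" "\<forall>x y. x \<noteq> y \<longrightarrow>
        norm (g x - g y) \<le> (e/2) * \<omega> (norm (x - y)) \<longrightarrow> norm (f x - f y) \<le> e * \<omega> (norm (x - y))"
      using approx[OF e] by (rule bexE)
    obtain S where "S > 0" "\<forall>x y. x \<noteq> y \<longrightarrow> S < norm x \<longrightarrow> S < norm y \<longrightarrow>
        norm (g x - g y) \<le> (e/2) * \<omega> (norm (x - y))"
      using g(1) half_gt_zero[OF e] unfolding VC_def Int_iff VC_far_iff by blast
    then show "\<exists>S>0. \<forall>x y. x \<noteq> y \<longrightarrow> S < norm x \<longrightarrow> S < norm y \<longrightarrow>
        norm (f x - f y) \<le> e * \<omega> (norm (x - y))"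
      using g(2) by (intro exI[of _ S]) simp
  qed
  ultimately show "f \<in> VC \<omega>" by (simp add: VC_def)
qed

section \<open>Growth of f away from the origin\<close>

text \<open>After division by R, the left side is the increment of f from the origin times the
  change of a cutoff of slope 1/R over a distance t. The threshold \<open>R\<^sub>1\<close> depends
  on neither t nor y.\<close>

lemma growth_bound:
  fixes f :: "'a::real_normed_vector \<Rightarrow> 'b::real_normed_vector"
  assumes f: "f \<in> VC_large \<omega>" "f \<in> VC_far \<omega>" and e: "e > 0"
  obtains R\<^sub>1 where "R\<^sub>1 > 0"
    "\<And>R y t. R\<^sub>1 \<le> R \<Longrightarrow> R \<le> norm y \<Longrightarrow> norm y \<le> 4 * R \<Longrightarrow> 0 < t \<Longrightarrow> t \<le> R \<Longrightarrow>
      t * norm (f y - f 0) \<le> e * R * \<omega> t"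
proof -
  obtain K where K: "K \<ge> 0" "\<And>x y. x \<noteq> y \<Longrightarrow> norm (f x - f y) \<le> K * \<omega> (norm (x - y))"
    using f by (auto simp: VC_large_iff holder_space_iff)
  \<comment> \<open>Chaining over a length of at most 4R brings a factor 8R, so e/16 consumes half
    of e * R.\<close>
  have e16: "e/16 > 0" using e by simp
  obtain S where S: "S > 0"
      "\<And>x y. S \<le> norm (x - y) \<Longrightarrow> norm (f x - f y) \<le> (e/16) * \<omega> (norm (x - y))"
    using f(1) e16 unfolding VC_large_iff by blast
  obtain Q where Q: "Q > 0"
      "\<And>x y. x \<noteq> y \<Longrightarrow> Q < norm x \<Longrightarrow> Q < norm y \<Longrightarrow> norm (f x - f y) \<le> (e/16) * \<omega> (norm (x - y))"
    using f(2) e16 unfolding VC_far_iff by blast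
  define P where "P = Q + 2 * S"
  define R\<^sub>1 where "R\<^sub>1 = max (P + 2 * S) (4 * K * P / e)"
  have P: "P > 0" "Q < P" "2 * S \<le> P" using S Q by (auto simp: P_def)
  show thesis
  proof (rule that[of R\<^sub>1])
    show "R\<^sub>1 > 0" using P S by (simp add: R\<^sub>1_def less_max_iff_disj)
    fix R t :: real and y :: 'a
    assume R: "R\<^sub>1 \<le> R" "R \<le> norm y" "norm y \<le> 4 * R" and t: "0 < t" "t \<le> R"
    have R0: "R > 0" using t by linarith
    have RP: "P + 2 * S \<le> R" using R(1) by (simp add: R\<^sub>1_def)
    have KP: "4 * K * P \<le> e * R" using R(1) e by (simp add: R\<^sub>1_def field_simps)
    have \<omega>t: "\<omega> t > 0" using pos t by simp
    show "t * norm (f y - f 0) \<le> e * R * \<omega> t"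
    proof (cases "t \<ge> 2 * S")
      case True
      \<comment> \<open>Every piece has length at least t/2, hence at least S, so the large-scale
        bound covers the whole segment.\<close>
      have "t * norm (f y - f 0) \<le> 2 * norm (y - 0) * ((e/16) * \<omega> t)"
      proof (rule scaled_norm_diff_le_chain)
        fix u v :: 'a assume "t / 2 \<le> norm (u - v)" "norm (u - v) \<le> t"
        then have "norm (f u - f v) \<le> (e/16) * \<omega> (norm (u - v))" "\<omega> (norm (u - v)) \<le> \<omega> t"
          using S(2)[of u v] True t by (auto intro!: le)
        then show "norm (f u - f v) \<le> (e/16) * \<omega> t"
          using e by (smt (verit) mult_left_mono e16)
      qed (use t R in auto)
      also have "\<dots> \<le> 2 * (4 * R) * ((e/16) * \<omega> t)"
        using R \<omega>t e by (intro mult_right_mono) auto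
      also have "\<dots> \<le> e * R * \<omega> t" using R0 \<omega>t e by simp
      finally show ?thesis .
    next
      case False
      define z where "z = (P / norm y) *\<^sub>R y"
      have ny: "norm y > 0" using R R0 by linarith
      have nz: "norm z = P" using ny P by (simp add: z_def)
      have "t * norm (f z - f 0) \<le> 2 * norm (z - 0) * (K * \<omega> t)"
      proof (rule scaled_norm_diff_le_chain)
        fix u v :: 'a assume uv: "t / 2 \<le> norm (u - v)" "norm (u - v) \<le> t"
        then have "u \<noteq> v" using t by auto
        then have "norm (f u - f v) \<le> K * \<omega> (norm (u - v))" "\<omega> (norm (u - v)) \<le> \<omega> t"
          using K(2)[of u v] uv by (auto intro!: le)
        then show "norm (f u - f v) \<le> K * \<omega> t" using K(1) by (smt (verit) mult_left_mono)
      qed (use t False nz P in auto)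
      also have "\<dots> = (4 * K * P) / 2 * \<omega> t" using nz by simp
      also have "\<dots> \<le> (e * R) / 2 * \<omega> t" using KP \<omega>t by (intro mult_right_mono) auto
      finally have 1: "t * norm (f z - f 0) \<le> (e * R) / 2 * \<omega> t" .
      have yz: "y - z = (1 - P / norm y) *\<^sub>R y" by (simp add: z_def scaleR_diff_left)
      have "P / norm y \<le> 1" using ny P R RP S by simp
      then have nyz: "norm (y - z) = norm y - P" using ny unfolding yz by (simp add: field_simps)
      have "t * norm (f y - f z) \<le> 2 * norm (y - z) * ((e/16) * \<omega> t)"
      proof (rule scaled_norm_diff_le_chain)
        fix u v :: 'a assume uv: "t / 2 \<le> norm (u - v)" "norm (u - v) \<le> t"
          "u \<in> closed_segment y z" "v \<in> closed_segment y z"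
        \<comment> \<open>Since y and z lie on one ray from 0, the norm of a point between them is
          the convex combination of \<open>norm y\<close> and P, hence at least P.\<close>
        have far: "Q < norm w" if w: "w \<in> closed_segment y z" for w
        proof -
          obtain a where a: "0 \<le> a" "a \<le> 1" "w = (1 - a) *\<^sub>R y + a *\<^sub>R z"
            using w by (auto simp: in_segment)
          have "w = ((1 - a) + a * (P / norm y)) *\<^sub>R y"
            by (simp add: a(3) z_def scaleR_add_left)
          then have "norm w = \<bar>(1 - a) + a * (P / norm y)\<bar> * norm y" by simp
          also have "\<bar>(1 - a) + a * (P / norm y)\<bar> = (1 - a) + a * (P / norm y)"
            using a P ny by simp
          also have "\<dots> * norm y = (1 - a) * norm y + a * P" using ny by (simp add: field_simps)
          also have "\<dots> \<ge> (1 - a) * P + a * P"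
            using a R RP S by (intro add_mono mult_left_mono) auto
          finally show ?thesis using P by (simp add: algebra_simps)
        qed
        have "u \<noteq> v" using uv t by auto
        then have "norm (f u - f v) \<le> (e/16) * \<omega> (norm (u - v))" "\<omega> (norm (u - v)) \<le> \<omega> t"
          using Q(2)[of u v] far uv by (auto intro!: le)
        then show "norm (f u - f v) \<le> (e/16) * \<omega> t" by (smt (verit) mult_left_mono e16)
      qed (use t False nyz R RP in auto)
      also have "\<dots> \<le> 2 * (4 * R) * ((e/16) * \<omega> t)"
        using R nyz P \<omega>t e by (intro mult_right_mono) auto
      also have "\<dots> = (e * R) / 2 * \<omega> t" by simp
      finally have 2: "t * norm (f y - f z) \<le> (e * R) / 2 * \<omega> t" .
      have "norm (f y - f 0) \<le> norm (f y - f z) + norm (f z - f 0)"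
        using norm_triangle_ineq[of "f y - f z" "f z - f 0"] by simp
      then have "t * norm (f y - f 0) \<le> t * norm (f y - f z) + t * norm (f z - f 0)"
        using t by (simp flip: distrib_left)
      also have "\<dots> \<le> (e * R) / 2 * \<omega> t + (e * R) / 2 * \<omega> t" by (rule add_mono[OF 2 1])
      finally show ?thesis by (simp add: mult_ac)
    qed
  qed
qed

end

section \<open>The radial cutoff\<close>

definition cutoff :: "real \<Rightarrow> 'a::real_normed_vector \<Rightarrow> real"
  where "cutoff R x = max 0 (min 1 (2 - norm x / (2 * R)))"

lemma cutoff_bounds: "0 \<le> cutoff R x" "cutoff R x \<le> 1"
  by (auto simp: cutoff_def)

lemma cutoff_eq_1: "R > 0 \<Longrightarrow> norm x \<le> 2 * R \<Longrightarrow> cutoff R x = 1"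
  by (auto simp: cutoff_def field_simps)

lemma cutoff_eq_0: "R > 0 \<Longrightarrow> 4 * R \<le> norm x \<Longrightarrow> cutoff R x = 0"
  by (auto simp: cutoff_def field_simps)

text \<open>Clamping to [0, 1] does not increase distances, and the norm is 1-Lipschitz. The slope
  1/(2R) is rounded up to 1/R, the factor that \<open>growth_bound\<close> controls.\<close>

lemma cutoff_lipschitz:
  assumes "R > 0"
  shows "\<bar>cutoff R x - cutoff R y\<bar> \<le> norm (x - y) / R"
proof -
  have "\<bar>cutoff R x - cutoff R y\<bar> \<le> \<bar>norm x / (2 * R) - norm y / (2 * R)\<bar>"
    unfolding cutoff_def by linarith
  also have "\<dots> = \<bar>norm x - norm y\<bar> / (2 * R)"
    using assms by (simp flip: diff_divide_distrib)
  also have "\<dots> \<le> norm (x - y) / (2 * R)"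
    using assms norm_triangle_ineq3[of x y] by (intro divide_right_mono) auto
  also have "\<dots> \<le> norm (x - y) / R" using assms by (simp add: field_simps)
  finally show ?thesis .
qed

context modulus
begin

section \<open>Approximation by cutoffs\<close>

lemma cutoff_error:
  fixes f :: "'a::real_normed_vector \<Rightarrow> 'b::real_normed_vector"
  assumes infinity: "filterlim \<omega> at_top at_top"
    and f: "f \<in> VC_large \<omega>" "f \<in> VC_far \<omega>" and e: "e > 0"
  obtains R where "R > 0"
    "holder_seminorm \<omega> (\<lambda>x. cutoff R x *\<^sub>R (f x - f 0) - f x) \<le> ennreal (2 * e)"
proof -
  obtain K where K: "K \<ge> 0" "\<And>x y. x \<noteq> y \<Longrightarrow> norm (f x - f y) \<le> K * \<omega> (norm (x - y))"
    using f by (auto simp: VC_large_iff holder_space_iff)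
  obtain S where S: "S > 0"
      "\<And>x y. S \<le> norm (x - y) \<Longrightarrow> norm (f x - f y) \<le> e * \<omega> (norm (x - y))"
    using f(1) e unfolding VC_large_iff by blast
  obtain Q where Q: "Q > 0"
      "\<And>x y. x \<noteq> y \<Longrightarrow> Q < norm x \<Longrightarrow> Q < norm y \<Longrightarrow> norm (f x - f y) \<le> e * \<omega> (norm (x - y))"
    using f(2) e unfolding VC_far_iff by blast
  obtain R\<^sub>1 where R1: "R\<^sub>1 > 0"
    "\<And>R y t. R\<^sub>1 \<le> R \<Longrightarrow> R \<le> norm y \<Longrightarrow> norm y \<le> 4 * R \<Longrightarrow> 0 < t \<Longrightarrow> t \<le> R \<Longrightarrow>
      t * norm (f y - f 0) \<le> e * R * \<omega> t"
    using growth_bound[OF f e] by blast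
  obtain T where T: "\<And>t. t \<ge> T \<Longrightarrow> K * \<omega> S / e \<le> \<omega> t"
    using infinity by (auto simp: filterlim_at_top eventually_at_top_linorder)
  \<comment> \<open>\<open>R\<^sub>1\<close> serves \<open>growth_bound\<close>, and T gives
    \<open>K * \<omega> S \<le> e * \<omega> R\<close>; S and Q turn pairs straddling the region
    near 0 into pairs at large distance.\<close>
  define R where "R = max (max S Q) (max R\<^sub>1 T)"
  have R: "R > 0" "S \<le> R" "Q \<le> R" "R\<^sub>1 \<le> R" "T \<le> R" using S by (auto simp: R_def)
  define h where "h x = (1 - cutoff R x) *\<^sub>R (f x - f 0)" for x
  \<comment> \<open>Increments from 0 within S are bounded by \<open>K * \<omega> S\<close> and
    absorbed by the choice of T; longer ones fall under the large-scale bound.\<close>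
  have inner: "norm (f y - f 0) \<le> e * \<omega> R" if y: "norm y \<le> R" for y
  proof -
    consider "y = 0" | "y \<noteq> 0" "norm y < S" | "S \<le> norm y" by linarith
    then show ?thesis
    proof cases
      case 1 then show ?thesis using e pos R by (simp add: less_imp_le)
    next
      case 2
      then have "norm (f y - f 0) \<le> K * \<omega> (norm y)" using K(2)[of y 0] by simp
      also have "\<dots> \<le> K * \<omega> S" using 2 K(1) by (intro mult_left_mono le) auto
      also have "\<dots> \<le> e * \<omega> R" using T[of R] R e by (simp add: field_simps)
      finally show ?thesis .
    next
      case 3
      then have "norm (f y - f 0) \<le> e * \<omega> (norm y)" using S(2)[of y 0] by simp
      also have "\<dots> \<le> e * \<omega> R" using 3 S(1) y e by (intro mult_left_mono le) auto
      finally show ?thesis .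
    qed
  qed
  \<comment> \<open>By symmetry x may be the outer point. If even x lies within 2R, then h vanishes
    at both points.\<close>
  have ordered: "norm (h x - h y) \<le> 2 * e * \<omega> (norm (x - y))"
    if xy: "x \<noteq> y" "norm y \<le> norm x" for x y
  proof (cases "norm x \<le> 2 * R")
    case True
    then show ?thesis using xy R(1) cutoff_eq_1[of R x] cutoff_eq_1[of R y] pos[of "norm (x - y)"] e
      by (simp add: h_def)
  next
    case x: False
    define t where "t = norm (x - y)"
    have t: "t > 0" "\<omega> t > 0" using xy pos by (auto simp: t_def)
    have tri: "norm x \<le> norm y + t" unfolding t_def using norm_triangle_sub[of x y] by simp
    \<comment> \<open>The product is split so that the change of the cutoff multiplies the increment
      at the inner point y. Each summand gets the allowance e.\<close>
    have split: "h x - h y = (1 - cutoff R x) *\<^sub>R (f x - f y)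
        + (cutoff R y - cutoff R x) *\<^sub>R (f y - f 0)"
      by (simp add: h_def algebra_simps)
    have "norm (f x - f y) \<le> e * \<omega> t"
    proof (cases "Q < norm y")
      case True
      then show ?thesis using Q(2)[OF xy(1)] xy by (simp add: t_def)
    next
      case False
      \<comment> \<open>Here y has norm at most Q, hence at most R, and x has norm above 2R, so
        their distance exceeds S.\<close>
      then show ?thesis using S(2)[of x y] x tri R by (simp add: t_def)
    qed
    then have "norm ((1 - cutoff R x) *\<^sub>R (f x - f y)) \<le> 1 * (e * \<omega> t)"
      unfolding norm_scaleR using cutoff_bounds[of R x] by (intro mult_mono) auto
    then have term1: "norm ((1 - cutoff R x) *\<^sub>R (f x - f y)) \<le> e * \<omega> t" by simp
    consider "norm y < R" | "R \<le> norm y" "norm y \<le> 4 * R" | "4 * R \<le> norm y" by linarith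
    then have term2: "norm ((cutoff R y - cutoff R x) *\<^sub>R (f y - f 0)) \<le> e * \<omega> t"
    proof cases
      case 1
      \<comment> \<open>The points are more than R apart, so
        \<open>\<omega> R \<le> \<omega> t\<close>.\<close>
      have "\<bar>cutoff R y - cutoff R x\<bar> * norm (f y - f 0) \<le> 1 * (e * \<omega> R)"
        using cutoff_bounds[of R x] cutoff_bounds[of R y] inner 1 by (intro mult_mono) auto
      also have "\<dots> \<le> e * \<omega> t" using 1 x tri R(1) e by (simp add: le)
      finally show ?thesis by simp
    next
      case 2
      \<comment> \<open>\<open>growth_bound\<close> requires a distance of at most R. Beyond R the
        cutoff changes by at most 1 = R/R, so truncating t at R loses nothing.\<close>
      define s where "s = min t R"
      have s: "0 < s" "s \<le> R" "s \<le> t" using t R by (auto simp: s_def)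
      have "\<bar>cutoff R y - cutoff R x\<bar> \<le> s / R"
        using cutoff_lipschitz[OF R(1), of y x] cutoff_bounds[of R x] cutoff_bounds[of R y] R(1)
        by (auto simp: s_def t_def min_def norm_minus_commute)
      then have "\<bar>cutoff R y - cutoff R x\<bar> * norm (f y - f 0) \<le> s / R * norm (f y - f 0)"
        by (intro mult_right_mono) auto
      also have "\<dots> \<le> e * \<omega> s"
        using R1(2)[OF R(4) 2 s(1,2)] R(1) by (simp add: field_simps)
      also have "\<dots> \<le> e * \<omega> t" using s e by (simp add: le)
      finally show ?thesis by simp
    next
      case 3
      then show ?thesis using cutoff_eq_0[of R x] cutoff_eq_0[of R y] R(1) xy t e by simp
    qed
    have "norm (h x - h y) \<le> norm ((1 - cutoff R x) *\<^sub>R (f x - f y))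
        + norm ((cutoff R y - cutoff R x) *\<^sub>R (f y - f 0))"
      unfolding split by (rule norm_triangle_ineq)
    then show ?thesis using term1 term2 by (simp add: t_def)
  qed
  have hbound: "norm (h x - h y) \<le> 2 * e * \<omega> (norm (x - y))" if "x \<noteq> y" for x y
    using ordered[of x y] ordered[of y x] that by (cases "norm y \<le> norm x") (auto simp: norm_minus_commute)
  \<comment> \<open>The error is -h up to the constant \<open>f 0\<close>, which the seminorm
    ignores.\<close>
  have "(cutoff R x *\<^sub>R (f x - f 0) - f x) - (cutoff R y *\<^sub>R (f y - f 0) - f y) = - (h x - h y)" for x y
    by (simp add: h_def algebra_simps)
  then have "holder_seminorm \<omega> (\<lambda>x. cutoff R x *\<^sub>R (f x - f 0) - f x) \<le> ennreal (2 * e)"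
    using hbound e by (subst holder_seminorm_le_iff) (auto simp: norm_minus_commute)
  then show thesis using that R(1) by blast
qed

text \<open>A product rule: the cutoff is bounded and f oscillates little at small scales, while the
  Lipschitz cutoff times the bounded increment of f contributes O(t), which is o(\<omega>(t)) as t
  tends to 0.\<close>

lemma cutoff_VC_small:
  fixes f :: "'a::real_normed_vector \<Rightarrow> 'b::real_normed_vector"
  assumes quotient: "((\<lambda>t. t / \<omega> t) \<longlongrightarrow> 0) (at_right 0)"
    and f: "f \<in> VC_small \<omega>" and R: "R > 0"
    and hg: "(\<lambda>x. cutoff R x *\<^sub>R (f x - f 0)) \<in> holder_space \<omega>"
  shows "(\<lambda>x. cutoff R x *\<^sub>R (f x - f 0)) \<in> VC_small \<omega>"
    (is "?g \<in> _")
  unfolding VC_small_iff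
proof (intro conjI hg allI impI)
  fix e :: real assume e: "e > 0"
  obtain K where K: "K \<ge> 0" "\<And>x y. x \<noteq> y \<Longrightarrow> norm (f x - f y) \<le> K * \<omega> (norm (x - y))"
    using f by (auto simp: VC_small_iff holder_space_iff)
  have "e / 2 > 0" using e by simp
  then obtain d where d: "d > 0"
      "\<And>x y. x \<noteq> y \<Longrightarrow> norm (x - y) < d \<Longrightarrow> norm (f x - f y) \<le> (e / 2) * \<omega> (norm (x - y))"
    using f unfolding VC_small_iff by blast
  define M where "M = K * \<omega> (4 * R)"
  have M: "M \<ge> 0" using K(1) pos[of "4 * R"] R by (simp add: M_def)
  have g_bound: "norm (f y - f 0) \<le> M" if "norm y \<le> 4 * R" for y
  proof (cases "y = 0")
    case False
    then have "norm (f y - f 0) \<le> K * \<omega> (norm y)" using K(2)[of y 0] by simp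
    also have "\<dots> \<le> M" unfolding M_def using False that K(1) by (intro mult_left_mono le) auto
    finally show ?thesis .
  qed (use M in simp)
  have "((\<lambda>t. M / R * (t / \<omega> t)) \<longlongrightarrow> M / R * 0) (at_right 0)"
    by (intro tendsto_intros quotient)
  then have "eventually (\<lambda>t. M / R * (t / \<omega> t) < e / 2) (at_right 0)"
    using e by (intro order_tendstoD(2)) auto
  then obtain d' where d': "d' > 0" "\<And>t. 0 < t \<Longrightarrow> t < d' \<Longrightarrow> M / R * (t / \<omega> t) < e / 2"
    by (auto simp: eventually_at_right_field)
  \<comment> \<open>With y the inner point, either y lies within 4R, where M bounds the increment
    from 0, or both cutoffs vanish.\<close>
  have ordered: "norm (?g x - ?g y) \<le> e * \<omega> (norm (x - y))"
    if xy: "x \<noteq> y" "norm (x - y) < min d d'" "norm y \<le> norm x" for x y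
  proof -
    define t where "t = norm (x - y)"
    have t: "t > 0" "\<omega> t > 0" "t < d" "t < d'" using xy pos by (auto simp: t_def)
    have split: "?g x - ?g y = cutoff R x *\<^sub>R (f x - f y) + (cutoff R x - cutoff R y) *\<^sub>R (f y - f 0)"
      by (simp add: algebra_simps)
    have "norm (cutoff R x *\<^sub>R (f x - f y)) \<le> 1 * ((e / 2) * \<omega> t)"
      unfolding norm_scaleR using cutoff_bounds[of R x] d(2)[OF xy(1)] t(3)
      by (intro mult_mono) (auto simp: t_def)
    moreover have "norm ((cutoff R x - cutoff R y) *\<^sub>R (f y - f 0)) \<le> (e / 2) * \<omega> t"
    proof (cases "norm y \<le> 4 * R")
      case True
      have "norm ((cutoff R x - cutoff R y) *\<^sub>R (f y - f 0)) \<le> t / R * M"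
        unfolding norm_scaleR real_norm_def t_def using cutoff_lipschitz[OF R] g_bound[OF True] R
        by (intro mult_mono) auto
      also have "\<dots> \<le> (e / 2) * \<omega> t"
        using d'(2)[OF t(1,4)] t R by (simp add: field_simps)
      finally show ?thesis .
    next
      case False
      then show ?thesis using cutoff_eq_0[of R x] cutoff_eq_0[of R y] R xy t e by simp
    qed
    ultimately show ?thesis
      unfolding split using norm_triangle_ineq[of "cutoff R x *\<^sub>R (f x - f y)"
          "(cutoff R x - cutoff R y) *\<^sub>R (f y - f 0)"] by (simp add: t_def)
  qed
  have "norm (?g x - ?g y) \<le> e * \<omega> (norm (x - y))" if "x \<noteq> y" "norm (x - y) < min d d'" for x y
    using ordered[of x y] ordered[of y x] that
    by (cases "norm y \<le> norm x") (auto simp: norm_minus_commute)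
  then show "\<exists>d>0. \<forall>x y. x \<noteq> y \<longrightarrow> norm (x - y) < d \<longrightarrow> norm (?g x - ?g y) \<le> e * \<omega> (norm (x - y))"
    using d(1) d'(1) by (intro exI[of _ "min d d'"]) auto
qed

lemma VC_approx:
  fixes f :: "'a::real_normed_vector \<Rightarrow> 'b::real_normed_vector"
  assumes zero: "(\<omega> \<longlongrightarrow> 0) (at_right 0)"
    and infinity: "filterlim \<omega> at_top at_top"
    and quotient: "((\<lambda>t. t / \<omega> t) \<longlongrightarrow> 0) (at_right 0)"
    and f: "f \<in> VC \<omega>" and e: "e > 0"
  shows "\<exists>g\<in>VC_small \<omega> \<inter> C_bs. holder_seminorm \<omega> (\<lambda>x. g x - f x) \<le> ennreal e"
proof -
  have f': "f \<in> VC_small \<omega>" "f \<in> VC_large \<omega>" "f \<in> VC_far \<omega>" using f by (auto simp: VC_def)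
  define g where "g R x = cutoff R x *\<^sub>R (f x - f 0)" for R x
  obtain R where R: "R > 0" "holder_seminorm \<omega> (\<lambda>x. g R x - f x) \<le> ennreal (2 * (e / 2))"
    unfolding g_def using cutoff_error[OF infinity f'(2,3), of "e / 2"] e by auto
  obtain K where K: "K \<ge> 0" "\<And>x y. x \<noteq> y \<Longrightarrow> norm (f x - f y) \<le> K * \<omega> (norm (x - y))"
    using f' by (auto simp: VC_large_iff holder_space_iff)
  \<comment> \<open>Writing \<open>g R\<close> as f plus the error gives the Holder bound from those
    already known, without estimating the product again.\<close>
  have hg: "g R \<in> holder_space \<omega>"
    unfolding holder_space_iff
  proof (intro exI[of _ "K + e"] conjI allI impI)
    fix x y :: 'a assume xy: "x \<noteq> y"
    have "norm ((g R x - f x) - (g R y - f y)) \<le> e * \<omega> (norm (x - y))"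
      using R(2) e xy by (simp add: holder_seminorm_le_iff)
    moreover have "g R x - g R y = (f x - f y) + ((g R x - f x) - (g R y - f y))" by simp
    then have "norm (g R x - g R y) \<le> norm (f x - f y) + norm ((g R x - f x) - (g R y - f y))"
      by (metis norm_triangle_ineq)
    ultimately show "norm (g R x - g R y) \<le> (K + e) * \<omega> (norm (x - y))"
      using K(2)[OF xy] by (simp add: distrib_right)
  qed (use K e in auto)
  have "g R \<in> VC_small \<omega>"
    using cutoff_VC_small[OF quotient f'(1) R(1)] hg by (simp add: g_def[abs_def])
  moreover have "g R \<in> C_bs"
    unfolding C_bs_def using continuous_on_holder_space[OF zero hg] R(1)
    by (auto intro!: exI[of _ "4 * R"] simp: g_def cutoff_eq_0)
  ultimately show ?thesis using R(2) by auto
qed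

end

section \<open>The two inclusions\<close>

theorem theorem1p2:
  fixes \<omega> :: "real \<Rightarrow> real" and C\<^sub>d\<^sub>b :: real
  assumes \<omega>_pos: "\<And>t. t > 0 \<Longrightarrow> \<omega> t > 0"
    and \<omega>_mono: "mono_on {0<..} \<omega>"
    and \<omega>_zero: "(\<omega> \<longlongrightarrow> 0) (at_right 0)"
    and \<omega>_infinity: "filterlim \<omega> at_top at_top"
    and \<omega>_quotient: "((\<lambda>t. t / \<omega> t) \<longlongrightarrow> 0) (at_right 0)"
    and C_db: "C\<^sub>d\<^sub>b > 1"
    and doubling: "\<And>t. t > 0 \<Longrightarrow> \<omega> (2 * t) \<le> C\<^sub>d\<^sub>b * \<omega> t"
  shows "(VC \<omega> :: ('a::real_normed_vector \<Rightarrow> 'b::real_normed_vector) set) =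
    holder_closure \<omega> (VC_small \<omega> \<inter> C_bs)"
proof -
  interpret modulus \<omega> using \<omega>_pos \<omega>_mono by unfold_locales
  show ?thesis
  proof
    show "(VC \<omega> :: ('a \<Rightarrow> 'b) set) \<subseteq> holder_closure \<omega> (VC_small \<omega> \<inter> C_bs)"
    proof
      fix f :: "'a \<Rightarrow> 'b" assume f: "f \<in> VC \<omega>"
      have "\<exists>g\<in>VC_small \<omega> \<inter> C_bs. holder_seminorm \<omega> (\<lambda>x. g x - f x) \<le> ennreal (1 / real (Suc n))" for n
        by (rule VC_approx[OF \<omega>_zero \<omega>_infinity \<omega>_quotient f]) simp
      then obtain F where F: "\<And>n. F n \<in> VC_small \<omega> \<inter> C_bs"
          "\<And>n. holder_seminorm \<omega> (\<lambda>x. F n x - f x) \<le> ennreal (1 / real (Suc n))"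
        by metis
      have lim: "(\<lambda>n. ennreal (1 / real (Suc n))) \<longlonglongrightarrow> 0"
        unfolding ennreal_0[symmetric]
        by (rule tendsto_ennrealI[OF LIMSEQ_inverse_real_of_nat[unfolded inverse_eq_divide]])
      have "(\<lambda>n. holder_seminorm \<omega> (\<lambda>x. F n x - f x)) \<longlonglongrightarrow> 0"
        by (rule tendsto_sandwich[OF always_eventually always_eventually tendsto_const lim])
          (intro allI zero_le F(2))+
      then show "f \<in> holder_closure \<omega> (VC_small \<omega> \<inter> C_bs)"
        using f F(1) by (auto simp: holder_closure_def VC_def VC_small_def)
    qed
    \<comment> \<open>Bounded support supplies the other two vanishing conditions, so monotonicity
      and closedness of \<open>VC \<omega>\<close> give the reverse inclusion.\<close>
    have "(VC_small \<omega> \<inter> C_bs :: ('a \<Rightarrow> 'b) set) \<subseteq> VC \<omega>"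
      using holder_C_bs_in_VC_large[OF \<omega>_infinity] holder_C_bs_in_VC_far
      by (auto simp: VC_def VC_small_def)
    then have "(holder_closure \<omega> (VC_small \<omega> \<inter> C_bs) :: ('a \<Rightarrow> 'b) set) \<subseteq> holder_closure \<omega> (VC \<omega>)"
      unfolding holder_closure_def by blast
    then show "holder_closure \<omega> (VC_small \<omega> \<inter> C_bs) \<subseteq> (VC \<omega> :: ('a \<Rightarrow> 'b) set)"
      using holder_closure_VC_subset by blast
  qed
qed

end
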